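(* Every finite nonempty poset $P$ satisfies $$\operatorname{gap}(P)\le 2\,\mathrm{w}(P)-1 .$$
   Context: A linear extension of a finite poset $P$ with $n$ elements is an order-preserving bijection $f:P\to\{1,\dots,n\}$. For $x\in P$, $h_P(x)=\mathbb E[f(x)]$, where $f$ is a uniformly random linear extension of $P$. If $s_1\le\cdots\le s_n$ are the values $h_P(x)$, $x\in P$, listed with repetition, then $$\operatorname{gap}(P)=\max\{s_1,\ s_2-s_1,\ \ldots,\ s_n-s_{n-1},\ n+1-s_n\}.$$ The width $\mathrm{w}(P)$ is the largest size of a pairwise incomparable subset (antichain) of $P$. *)

theory Defs
  imports "HOL-Probability.Probability"
begin

text \<open>A finite poset is a finite carrier \<open>A\<close> with a reflexive order relation \<open>r\<close> such that
  \<open>partial_order_on A r\<close>; \<open>(x, y) \<in> r\<close> means \<open>x \<le> y\<close> in the poset.\<close>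

text \<open>The extensional function space \<open>\<rightarrow>\<^sub>E\<close> makes each linear extension a unique HOL function, so that
  the set is finite and its uniform distribution is the intended one.\<close>

definition linear_extensions :: "'a set \<Rightarrow> 'a rel \<Rightarrow> ('a \<Rightarrow> nat) set" where
  "linear_extensions A r =
     {f \<in> A \<rightarrow>\<^sub>E {1..card A}. bij_betw f A {1..card A} \<and> (\<forall>(x, y) \<in> r. f x \<le> f y)}"

definition avg_height :: "'a set \<Rightarrow> 'a rel \<Rightarrow> 'a \<Rightarrow> real" where
  "avg_height A r x =
     measure_pmf.expectation (pmf_of_set (linear_extensions A r)) (\<lambda>f. real (f x))"

definition sorted_heights :: "'a set \<Rightarrow> 'a rel \<Rightarrow> real list" where
  "sorted_heights A r = sorted_list_of_multiset (image_mset (avg_height A r) (mset_set A))"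

text \<open>List positions start at \<open>0\<close>: \<open>s\<^sub>i\<close> is \<open>sorted_heights A r ! (i - 1)\<close>.\<close>

definition gap :: "'a set \<Rightarrow> 'a rel \<Rightarrow> real" where
  "gap A r =
     (let n = card A; s = sorted_heights A r in
      Max ({s ! 0} \<union> {s ! Suc i - s ! i | i. Suc i < n} \<union> {real n + 1 - s ! (n - 1)}))"

definition antichain :: "'a set \<Rightarrow> 'a rel \<Rightarrow> 'a set \<Rightarrow> bool" where
  "antichain A r B \<longleftrightarrow>
     B \<subseteq> A \<and> (\<forall>x\<in>B. \<forall>y\<in>B. x \<noteq> y \<longrightarrow> (x, y) \<notin> r \<and> (y, x) \<notin> r)"

definition width :: "'a set \<Rightarrow> 'a rel \<Rightarrow> nat" where
  "width A r = Max {card B | B. antichain A r B}"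

end

theory Submission
  imports Defs
begin

text \<open>
  Write \<open>e S\<close> for the number of linear extensions of the poset induced on \<open>S\<close>. Counting by the top
  element, a short induction shows \<open>e (J - x) e (J - y) \<le> e J e (J - x - y)\<close> for \<open>x\<close>, \<open>y\<close> maximal
  in \<open>J\<close>, so the probability \<open>p\<^sub>J x\<close> that \<open>x\<close> comes last in a random linear extension of \<open>J\<close> only
  grows when \<open>J\<close> shrinks to a down-set that still contains \<open>x\<close>. For two down-sets \<open>I\<close>, \<open>D\<close> this
  implies that the last element of \<open>I\<close> is a non-maximal element of \<open>D\<close> with probability at most that
  of the last element of \<open>D\<close> being outside \<open>I\<close>. Applying this to all initial segments \<open>I\<close> of a
  random linear extension of the whole poset shows that the heights of the maximal elements of \<open>D\<close>,
  averaged with weights \<open>p\<^sub>D\<close>, are at least \<open>|D| - |max D| + 1 \<ge> |D| - w + 1\<close>. So some element of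
  \<open>D\<close> has height at least \<open>|D| - w + 1\<close>; dually, some element of the complement has height at most
  \<open>|D| + w\<close>. Cutting the poset at a gap gives the bound \<open>2 w - 1\<close>.
\<close>

section \<open>Maximal elements, down-sets and top probabilities\<close>

definition maximals :: "'a rel \<Rightarrow> 'a set \<Rightarrow> 'a set" where
  "maximals r S = {z \<in> S. \<forall>y\<in>S. (z, y) \<in> r \<longrightarrow> y = z}"

abbreviation extensions_on :: "'a rel \<Rightarrow> 'a set \<Rightarrow> ('a \<Rightarrow> nat) set" where
  "extensions_on r S \<equiv> linear_extensions S (Restr r S)"

definition num_ext :: "'a rel \<Rightarrow> 'a set \<Rightarrow> real" where
  "num_ext r S = real (card (extensions_on r S))"

text \<open>The probability that \<open>x\<close> is last in a random linear extension of
  \<open>S\<close>, provided \<open>x\<close> is maximal in \<open>S\<close>. For other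
  \<open>x\<close> the quotient has no such meaning, so the sums below range over maximal
  elements.\<close>

definition top_prob :: "'a rel \<Rightarrow> 'a set \<Rightarrow> 'a \<Rightarrow> real" where
  "top_prob r S x = num_ext r (S - {x}) / num_ext r S"

text \<open>Applied to the converse relation, this describes up-sets.\<close>

definition down_closed :: "'a rel \<Rightarrow> 'a set \<Rightarrow> 'a set \<Rightarrow> bool" where
  "down_closed r S I \<longleftrightarrow> I \<subseteq> S \<and> (\<forall>y\<in>I. \<forall>x\<in>S. (x, y) \<in> r \<longrightarrow> x \<in> I)"

lemma finite_maximals [simp]: "finite S \<Longrightarrow> finite (maximals r S)"
  by (simp add: maximals_def)

lemma maximals_subset: "maximals r S \<subseteq> S"
  by (auto simp: maximals_def)

lemma maximals_ne:
  assumes "trans r" "antisym r" "finite S" "S \<noteq> {}"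
  shows "maximals r S \<noteq> {}"
  using assms(3,4)
proof (induction S rule: finite_ne_induct)
  case (singleton x)
  then show ?case by (auto simp: maximals_def)
next
  case (insert x S)
  then obtain m where m: "m \<in> S" "\<forall>y\<in>S. (m, y) \<in> r \<longrightarrow> y = m" by (auto simp: maximals_def)
  show ?case
  proof (cases "(m, x) \<in> r")
    case True
    have "y = x" if "y \<in> insert x S" "(x, y) \<in> r" for y
      using that True m assms(1,2) by (metis antisymD insertE transD)
    then have "x \<in> maximals r (insert x S)" by (auto simp: maximals_def)
    then show ?thesis by blast
  next
    case False
    then have "m \<in> maximals r (insert x S)" using m by (auto simp: maximals_def)
    then show ?thesis by blast
  qed
qed

section \<open>Linear extensions of induced posets, counted by their top element\<close>

lemma finite_linear_extensions [simp]: "finite A \<Longrightarrow> finite (linear_extensions A r)"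
  unfolding linear_extensions_def by (rule finite_subset[of _ "A \<rightarrow>\<^sub>E {1..card A}"]) (auto intro: finite_PiE)

lemma extensions_on_iff:
  "f \<in> extensions_on r S \<longleftrightarrow> f \<in> extensional S \<and> bij_betw f S {1..card S} \<and>
     (\<forall>x\<in>S. \<forall>y\<in>S. (x, y) \<in> r \<longrightarrow> f x \<le> f y)"
  unfolding linear_extensions_def PiE_def bij_betw_def by auto

lemma extensions_on_empty: "extensions_on r {} = {\<lambda>_. undefined}"
  by (auto simp: linear_extensions_def bij_betw_def)

lemma num_ext_empty [simp]: "num_ext r {} = 1"
  unfolding num_ext_def extensions_on_empty by simp

lemma extension_upd:
  assumes "finite S" "z \<in> maximals r S" "f \<in> extensions_on r (S - {z})"
  shows "f(z := card S) \<in> extensions_on r S"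
proof -
  from assms(2) have z: "z \<in> S" and zmax: "\<And>y. y \<in> S \<Longrightarrow> (z, y) \<in> r \<Longrightarrow> y = z"
    by (auto simp: maximals_def)
  define n where "n = card (S - {z})"
  have cS: "card S = Suc n" unfolding n_def by (rule card.remove[OF assms(1) z])
  have f: "f \<in> extensional (S - {z})" "bij_betw f (S - {z}) {1..n}"
    "\<And>x y. x \<in> S - {z} \<Longrightarrow> y \<in> S - {z} \<Longrightarrow> (x, y) \<in> r \<Longrightarrow> f x \<le> f y"
    using assms(3) unfolding extensions_on_iff n_def by blast+
  have rng: "f x \<le> n" if "x \<in> S - {z}" for x
    using f(2) that by (auto simp: bij_betw_def)
  have "bij_betw (f(z := Suc n)) (S - {z}) {1..n}"
    using f(2) by (subst bij_betw_cong[where g = f]) auto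
  then have "bij_betw (f(z := Suc n)) (insert z (S - {z})) (insert (Suc n) {1..n})"
    using notIn_Un_bij_betw[of z "S - {z}" "f(z := Suc n)" "{1..n}"] by simp
  moreover have "insert z (S - {z}) = S" "insert (Suc n) {1..n} = {1..Suc n}" using z by auto
  ultimately have "bij_betw (f(z := Suc n)) S {1..Suc n}" by simp
  moreover have "f(z := Suc n) \<in> extensional S" using f(1) z by (auto simp: extensional_def)
  moreover have "(f(z := Suc n)) x \<le> (f(z := Suc n)) y" if "x \<in> S" "y \<in> S" "(x, y) \<in> r" for x y
    using that f(3)[of x y] zmax[of y] rng[of x] by (auto simp: le_SucI)
  ultimately show ?thesis unfolding extensions_on_iff cS by blast
qed

text \<open>An element above the one labelled \<open>card S\<close> would carry a label at least as
  large, hence the same label, and labels are distinct. Resetting to \<open>undefined\<close> keeps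
  the restriction extensional.\<close>

lemma extension_restrict:
  assumes "finite S" "S \<noteq> {}" "f \<in> extensions_on r S"
  obtains z where "z \<in> maximals r S" "f z = card S" "f(z := undefined) \<in> extensions_on r (S - {z})"
proof -
  have f: "f \<in> extensional S" "bij_betw f S {1..card S}"
    "\<And>x y. x \<in> S \<Longrightarrow> y \<in> S \<Longrightarrow> (x, y) \<in> r \<Longrightarrow> f x \<le> f y"
    using assms(3) unfolding extensions_on_iff by blast+
  have "card S \<in> {1..card S}" using assms(1,2) by (simp add: Suc_leI card_gt_0_iff)
  then obtain z where z: "z \<in> S" "f z = card S" using f(2) by (metis bij_betw_iff_bijections)
  have inj: "inj_on f S" using f(2) by (simp add: bij_betw_def)
  have zm: "z \<in> maximals r S"
  proof -
    have "y = z" if "y \<in> S" "(z, y) \<in> r" for y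
    proof -
      have "f y \<le> card S" using f(2) that(1) by (auto simp: bij_betw_def)
      then have "f y = f z" using f(3)[of z y] z that by simp
      then show ?thesis using inj_onD[OF inj] that(1) z(1) by blast
    qed
    then show ?thesis using z by (auto simp: maximals_def)
  qed
  have c: "card (S - {z}) = card S - 1" using z assms(1) by simp
  have "bij_betw f (S - {z}) ({1..card S} - {f z})"
    using f(2) z by (auto simp: bij_betw_def inj_on_def)
  moreover have "{1..card S} - {f z} = {1..card S - 1}" using z by auto
  ultimately have "bij_betw f (S - {z}) {1..card (S - {z})}" by (simp add: c)
  then have "bij_betw (f(z := undefined)) (S - {z}) {1..card (S - {z})}"
    by (subst bij_betw_cong[where g = f]) auto
  then have "f(z := undefined) \<in> extensions_on r (S - {z})"
    unfolding extensions_on_iff using f(1,3) by (auto simp: extensional_def)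
  then show ?thesis using that zm z by blast
qed

text \<open>Deleting the top element and putting it back are mutually inverse, so extensions of
  \<open>S\<close> correspond to pairs of a maximal \<open>z\<close> and an extension of
  \<open>S - {z}\<close>. The general summand \<open>F\<close> serves both for counting and for
  summing positions.\<close>

lemma sum_extensions_on:
  assumes "finite S" "S \<noteq> {}"
  shows "(\<Sum>f\<in>extensions_on r S. F f) =
    (\<Sum>z\<in>maximals r S. \<Sum>f\<in>extensions_on r (S - {z}). F (f(z := card S)))"
proof -
  let ?h = "\<lambda>(z, f). f(z := card S)"
  let ?X = "SIGMA z:maximals r S. extensions_on r (S - {z})"
  \<comment> \<open>After an update at \<open>z\<close> the label \<open>card S\<close> sits at
    \<open>z\<close> alone, so \<open>z\<close> can be read off the updated function.\<close>
  have less: "f x \<noteq> card S" if "x \<in> S" "x \<noteq> z" "f \<in> extensions_on r (S - {z})" "z \<in> S" for f x z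
  proof -
    have "f x \<in> {1..card (S - {z})}" using that unfolding extensions_on_iff bij_betw_def by blast
    moreover have "card (S - {z}) < card S" using that(4) assms(1) by (rule card_Diff1_less[rotated])
    ultimately show ?thesis by auto
  qed
  have "inj_on ?h ?X"
  proof (rule inj_onI, clarify)
    fix z f z' f'
    assume a: "z \<in> maximals r S" "f \<in> extensions_on r (S - {z})" "z' \<in> maximals r S"
      "f' \<in> extensions_on r (S - {z'})" "f(z := card S) = f'(z' := card S)"
    have zS: "z \<in> S" "z' \<in> S" using a by (auto simp: maximals_def)
    have zz: "z = z'"
    proof (rule ccontr)
      assume "z \<noteq> z'"
      then have "f' z = card S" using fun_cong[OF a(5), of z] by simp
      then show False using less[of z z' f'] \<open>z \<noteq> z'\<close> zS a(4) by blast
    qed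
    have "f x = f' x" for x
    proof (cases "x = z")
      case True
      then show ?thesis using a(2,4) zz unfolding extensions_on_iff by (auto simp: extensional_def)
    next
      case False
      then show ?thesis using fun_cong[OF a(5), of x] zz by simp
    qed
    then show "z = z' \<and> f = f'" using zz by auto
  qed
  moreover have "?h ` ?X = extensions_on r S"
  proof
    show "?h ` ?X \<subseteq> extensions_on r S" using extension_upd[OF assms(1)] by auto
    show "extensions_on r S \<subseteq> ?h ` ?X"
    proof
      fix f assume "f \<in> extensions_on r S"
      then obtain z where z: "z \<in> maximals r S" "f z = card S"
        "f(z := undefined) \<in> extensions_on r (S - {z})"
        using extension_restrict[OF assms] by blast
      then have "f = ?h (z, f(z := undefined))" by auto
      then show "f \<in> ?h ` ?X" using z by blast
    qed
  qed
  ultimately have "bij_betw ?h ?X (extensions_on r S)" by (simp add: bij_betw_def)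
  then have "(\<Sum>f\<in>extensions_on r S. F f) = (\<Sum>p\<in>?X. F (?h p))"
    by (simp add: sum.reindex_bij_betw[symmetric])
  also have "\<dots> = (\<Sum>z\<in>maximals r S. \<Sum>f\<in>extensions_on r (S - {z}). F (f(z := card S)))"
    using assms by (subst sum.Sigma) (auto simp: split_def)
  finally show ?thesis .
qed

lemma num_ext_rec:
  assumes "finite S" "S \<noteq> {}"
  shows "num_ext r S = (\<Sum>z\<in>maximals r S. num_ext r (S - {z}))"
  using sum_extensions_on[OF assms, where F = "\<lambda>_. 1::real"] by (simp add: num_ext_def)

section \<open>Log-supermodularity and the exchange inequality\<close>

context
  fixes r :: "'a rel"
  assumes trans: "trans r" and antisym: "antisym r"
begin

lemma num_ext_pos: "finite S \<Longrightarrow> num_ext r S > 0"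
proof (induction "card S" arbitrary: S rule: less_induct)
  case less
  show ?case
  proof (cases "S = {}")
    case False
    have "num_ext r (S - {z}) > 0" if "z \<in> maximals r S" for z
      using less.hyps[of "S - {z}"] less.prems that maximals_subset[of r S]
      by (meson card_Diff1_less finite_Diff subsetD)
    then show ?thesis
      unfolding num_ext_rec[OF less.prems False]
      using maximals_ne[OF trans antisym less.prems False] less.prems by (intro sum_pos) auto
  qed simp
qed

lemma sum_top_prob:
  assumes "finite S" "S \<noteq> {}"
  shows "(\<Sum>z\<in>maximals r S. top_prob r S z) = 1"
  using num_ext_pos[OF assms(1)] num_ext_rec[OF assms, of r]
  by (simp add: top_prob_def sum_divide_distrib[symmetric])

lemma top_prob_nonneg: "top_prob r S x \<ge> 0"
  by (simp add: top_prob_def num_ext_def)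

text \<open>With \<open>C = J - {x, y}\<close>, \<open>A = J - {x}\<close>, \<open>B = J - {y}\<close> and \<open>e\<close> for \<open>num_ext r\<close>,
  let \<open>a = e A / e C\<close> and \<open>a\<^sub>z = e (A - z) / e (C - z)\<close>, where \<open>a\<^sub>z = 0\<close> if \<open>z\<close> is not
  maximal in \<open>A\<close>; similarly \<open>b\<close>, \<open>b\<^sub>z\<close>. By induction \<open>a\<^sub>z \<le> a\<close> and \<open>b\<^sub>z \<le> b\<close>. The recursion gives
  \<open>a\<close> and \<open>b\<close> as one plus an average of the \<open>a\<^sub>z\<close> and \<open>b\<^sub>z\<close> and, by induction again, bounds
  \<open>e J / e C\<close> below by \<open>a + b\<close> plus the average of \<open>a\<^sub>z b\<^sub>z\<close>. Averaging
  \<open>(a - a\<^sub>z) (b - b\<^sub>z) \<ge> 0\<close> then yields \<open>e J / e C \<ge> a b\<close>.\<close>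

lemma num_ext_log_supermodular:
  assumes "finite J" "x \<in> maximals r J" "y \<in> maximals r J" "x \<noteq> y"
  shows "num_ext r (J - {x}) * num_ext r (J - {y}) \<le> num_ext r J * num_ext r (J - {x} - {y})"
  using assms
proof (induction "card J" arbitrary: J x y rule: less_induct)
  case less
  let ?e = "num_ext r" and ?M = "maximals r"
  define A where "A = J - {x}"
  define B where "B = J - {y}"
  define C where "C = J - {x} - {y}"
  have fin: "finite J" "finite A" "finite B" "finite C" using less.prems by (auto simp: A_def B_def C_def)
  have xy: "x \<in> J" "y \<in> J" "x \<noteq> y" using less.prems by (auto simp: maximals_def)
  have CA: "A - {y} = C" and CB: "B - {x} = C" by (auto simp: A_def B_def C_def)
  have ne: "A \<noteq> {}" "B \<noteq> {}" "J \<noteq> {}" using xy by (auto simp: A_def B_def)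
  have yA: "y \<in> ?M A" and xB: "x \<in> ?M B"
    using less.prems by (auto simp: maximals_def A_def B_def)
  have MA: "?M A - {y} \<subseteq> ?M C" and MB: "?M B - {x} \<subseteq> ?M C"
    by (auto simp: maximals_def A_def B_def C_def)
  \<comment> \<open>This determines the support of \<open>\<alpha> z * \<beta> z\<close>: unless
    \<open>z\<close> is maximal in \<open>J\<close>, one factor takes its default value 0.\<close>
  have "?M A \<inter> ?M B \<subseteq> ?M (A \<union> B)" "x \<notin> ?M A" "y \<notin> ?M B" by (auto simp: maximals_def A_def B_def)
  moreover have "A \<union> B = J" using xy by (auto simp: A_def B_def)
  ultimately have MJ: "?M A \<inter> ?M B \<subseteq> ?M J - {x} - {y}" by auto
  have cA: "card A < card J" and cB: "card B < card J"
    unfolding A_def B_def using xy fin(1) by (meson card_Diff1_less)+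
  show ?case
  \<comment> \<open>The averages are over the top element of \<open>C\<close>, so an empty
    \<open>C\<close> is treated apart. Then \<open>J\<close> is a two-element antichain and the
    claim reads \<open>1 \<le> 2\<close>.\<close>
  proof (cases "C = {}")
    case True
    then have "A = {y}" "B = {x}" "J = {x, y}" using xy by (auto simp: A_def B_def C_def)
    moreover have "?M {y} = {y}" "?M {x} = {x}" "?M J = {x, y}"
      using less.prems \<open>J = {x, y}\<close> by (auto simp: maximals_def)
    moreover have "?e {y} = 1" "?e {x} = 1"
      using num_ext_rec[of "{x}" r] num_ext_rec[of "{y}" r] \<open>?M {y} = {y}\<close> \<open>?M {x} = {x}\<close> by auto
    moreover have "?e J = ?e A + ?e B"
      using num_ext_rec[OF fin(1) ne(3), of r] \<open>?M J = {x, y}\<close> xy by (simp add: A_def B_def)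
    ultimately show ?thesis using True unfolding A_def[symmetric] B_def[symmetric] C_def[symmetric]
      by simp
  next
    case False
    have pos: "?e S > 0" if "finite S" for S using num_ext_pos that by blast
    define a where "a = ?e A / ?e C"
    define b where "b = ?e B / ?e C"
    define w where "w z = ?e (C - {z}) / ?e C" for z
    define \<alpha> where "\<alpha> z = (if z \<in> ?M A then ?e (A - {z}) / ?e (C - {z}) else 0)" for z
    define \<beta> where "\<beta> z = (if z \<in> ?M B then ?e (B - {z}) / ?e (C - {z}) else 0)" for z
    have eC: "?e C > 0" "\<And>z. ?e (C - {z}) > 0" using fin pos by auto
    have ab0: "a \<ge> 0" "b \<ge> 0" using pos fin by (auto simp: a_def b_def less_imp_le)
    have w0: "w z \<ge> 0" for z using eC by (simp add: w_def less_imp_le)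
    have w1: "(\<Sum>z\<in>?M C. w z) = 1"
      using sum_top_prob[OF fin(4) False] by (simp add: w_def top_prob_def)
    have \<alpha>_le: "\<alpha> z \<le> a" if "z \<in> ?M C" for z
    proof (cases "z \<in> ?M A")
      case True
      have "z \<noteq> y" using that by (auto simp: maximals_def C_def)
      then have "?e (A - {y}) * ?e (A - {z}) \<le> ?e A * ?e (A - {y} - {z})"
        using less.hyps[OF cA fin(2) yA True] by auto
      then show ?thesis using True eC(1) eC(2)[of z] by (simp add: \<alpha>_def a_def CA field_simps)
    qed (simp add: \<alpha>_def ab0)
    have \<beta>_le: "\<beta> z \<le> b" if "z \<in> ?M C" for z
    proof (cases "z \<in> ?M B")
      case True
      have "z \<noteq> x" using that by (auto simp: maximals_def C_def)
      then have "?e (B - {x}) * ?e (B - {z}) \<le> ?e B * ?e (B - {x} - {z})"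
        using less.hyps[OF cB fin(3) xB True] by auto
      then show ?thesis using True eC(1) eC(2)[of z] by (simp add: \<beta>_def b_def CB field_simps)
    qed (simp add: \<beta>_def ab0)
    have a_eq: "a = 1 + (\<Sum>z\<in>?M C. w z * \<alpha> z)"
    proof -
      \<comment> \<open>Removing \<open>y\<close> from \<open>A\<close> leaves \<open>C\<close>;
        this term becomes the \<open>1\<close> in the formula for \<open>a\<close>.\<close>
      have "?e A = ?e C + (\<Sum>z\<in>?M A - {y}. ?e (A - {z}))"
        using num_ext_rec[OF fin(2) ne(1), of r] sum.remove[OF _ yA, of "\<lambda>z. ?e (A - {z})"] fin CA by simp
      moreover have "(\<Sum>z\<in>?M A - {y}. ?e (A - {z}) / ?e C) = (\<Sum>z\<in>?M C. w z * \<alpha> z)"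
      proof (rule sum.mono_neutral_cong_left)
        show "\<forall>z\<in>?M C - (?M A - {y}). w z * \<alpha> z = 0"
          by (auto simp: \<alpha>_def) (auto simp: maximals_def C_def)
        show "?e (A - {z}) / ?e C = w z * \<alpha> z" if "z \<in> ?M A - {y}" for z
          using that eC(1) eC(2)[of z] by (simp add: \<alpha>_def w_def)
      qed (use fin MA in auto)
      ultimately show ?thesis using eC
        by (simp add: a_def add_divide_distrib sum_divide_distrib)
    qed
    have b_eq: "b = 1 + (\<Sum>z\<in>?M C. w z * \<beta> z)"
    proof -
      have "?e B = ?e C + (\<Sum>z\<in>?M B - {x}. ?e (B - {z}))"
        using num_ext_rec[OF fin(3) ne(2), of r] sum.remove[OF _ xB, of "\<lambda>z. ?e (B - {z})"] fin CB by simp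
      moreover have "(\<Sum>z\<in>?M B - {x}. ?e (B - {z}) / ?e C) = (\<Sum>z\<in>?M C. w z * \<beta> z)"
      proof (rule sum.mono_neutral_cong_left)
        show "\<forall>z\<in>?M C - (?M B - {x}). w z * \<beta> z = 0"
          by (auto simp: \<beta>_def) (auto simp: maximals_def C_def)
        show "?e (B - {z}) / ?e C = w z * \<beta> z" if "z \<in> ?M B - {x}" for z
          using that eC(1) eC(2)[of z] by (simp add: \<beta>_def w_def)
      qed (use fin MB in auto)
      ultimately show ?thesis using eC
        by (simp add: b_def add_divide_distrib sum_divide_distrib)
    qed
    have J_ge: "?e J / ?e C \<ge> a + b + (\<Sum>z\<in>?M C. w z * \<alpha> z * \<beta> z)"
    proof -
      have "?e J = ?e A + ?e B + (\<Sum>z\<in>?M J - {x} - {y}. ?e (J - {z}))"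
        using num_ext_rec[OF fin(1) ne(3), of r] less.prems fin
          sum.remove[of "?M J" x "\<lambda>z. ?e (J - {z})"] sum.remove[of "?M J - {x}" y "\<lambda>z. ?e (J - {z})"]
        by (simp add: A_def B_def)
      moreover have "(\<Sum>z\<in>?M C. w z * \<alpha> z * \<beta> z) \<le> (\<Sum>z\<in>?M J - {x} - {y}. ?e (J - {z}) / ?e C)"
      proof -
        have "(\<Sum>z\<in>?M C. w z * \<alpha> z * \<beta> z) = (\<Sum>z\<in>?M J - {x} - {y}. w z * \<alpha> z * \<beta> z)"
        proof (rule sum.mono_neutral_right)
          show "?M J - {x} - {y} \<subseteq> ?M C" by (auto simp: maximals_def C_def)
          show "\<forall>z\<in>?M C - (?M J - {x} - {y}). w z * \<alpha> z * \<beta> z = 0"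
            using MJ by (auto simp: \<alpha>_def \<beta>_def)
        qed (use fin in auto)
        also have "\<dots> \<le> (\<Sum>z\<in>?M J - {x} - {y}. ?e (J - {z}) / ?e C)"
        proof (rule sum_mono)
          fix z assume z: "z \<in> ?M J - {x} - {y}"
          then have zAB: "z \<in> ?M A" "z \<in> ?M B" by (auto simp: maximals_def A_def B_def)
          have "card (J - {z}) < card J"
            using z fin(1) maximals_subset[of r J] by (meson card_Diff1_less DiffD1 subsetD)
          moreover have "x \<in> ?M (J - {z})" "y \<in> ?M (J - {z})"
            using z less.prems by (auto simp: maximals_def)
          ultimately have "?e (J - {z} - {x}) * ?e (J - {z} - {y}) \<le> ?e (J - {z}) * ?e (J - {z} - {x} - {y})"
            using less.hyps[of "J - {z}" x y] fin xy by auto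
          moreover have "J - {z} - {x} = A - {z}" "J - {z} - {y} = B - {z}" "J - {z} - {x} - {y} = C - {z}"
            by (auto simp: A_def B_def C_def)
          \<comment> \<open>Divided by the square of \<open>?e (C - {z})\<close>, this bounds
            \<open>\<alpha> z * \<beta> z\<close> by
            \<open>?e (J - {z}) / ?e (C - {z})\<close>.\<close>
          ultimately have "?e (A - {z}) * ?e (B - {z}) \<le> ?e (J - {z}) * ?e (C - {z})" by simp
          then show "w z * \<alpha> z * \<beta> z \<le> ?e (J - {z}) / ?e C"
            using eC(1) eC(2)[of z] zAB by (simp add: w_def \<alpha>_def \<beta>_def field_simps)
        qed
        finally show ?thesis .
      qed
      ultimately show ?thesis
        by (simp add: a_def b_def add_divide_distrib sum_divide_distrib)
    qed
    have "0 \<le> (\<Sum>z\<in>?M C. w z * ((a - \<alpha> z) * (b - \<beta> z)))"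
      using \<alpha>_le \<beta>_le w0 by (intro sum_nonneg mult_nonneg_nonneg) auto
    also have "\<dots> = a * b * (\<Sum>z\<in>?M C. w z) - b * (\<Sum>z\<in>?M C. w z * \<alpha> z)
        - a * (\<Sum>z\<in>?M C. w z * \<beta> z) + (\<Sum>z\<in>?M C. w z * \<alpha> z * \<beta> z)"
      by (simp add: sum_distrib_left sum.distrib[symmetric] sum_subtractf[symmetric] algebra_simps)
    also have "\<dots> = a * b - b * (a - 1) - a * (b - 1) + (\<Sum>z\<in>?M C. w z * \<alpha> z * \<beta> z)"
      using a_eq b_eq w1 by simp
    finally have "a * b \<le> ?e J / ?e C" using J_ge by (simp add: algebra_simps)
    then have "?e A * ?e B \<le> ?e J * ?e C" using eC(1) by (simp add: a_def b_def field_simps)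
    then show ?thesis by (simp add: A_def B_def C_def)
  qed
qed

text \<open>Elements outside \<open>I\<close> are removed one at a time, each maximal in what
  remains. Log-supermodularity for the removed \<open>y\<close> and for \<open>z\<close> becomes,
  after division, \<open>top_prob r J z \<le> top_prob r (J - {y}) z\<close>.\<close>

lemma top_prob_antimono:
  assumes "finite J" "down_closed r J I" "z \<in> maximals r J" "z \<in> I"
  shows "top_prob r J z \<le> top_prob r I z"
  using assms
proof (induction "card (J - I)" arbitrary: J rule: less_induct)
  case less
  show ?case
  proof (cases "J = I")
    case False
    then have "J - I \<noteq> {}" using less.prems by (auto simp: down_closed_def)
    then obtain y where y: "y \<in> maximals r (J - I)"
      using maximals_ne[OF trans antisym, of "J - I"] less.prems(1) by auto
    \<comment> \<open>Nothing in \<open>I\<close> lies above \<open>y\<close>, because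
      \<open>I\<close> is a down-set that does not contain \<open>y\<close>.\<close>
    have yJ: "y \<in> maximals r J" and "y \<in> J" "y \<notin> I" "y \<noteq> z"
      using y less.prems by (auto simp: maximals_def down_closed_def)
    have "card (J - {y} - I) < card (J - I)"
      using less.prems(1) \<open>y \<in> J\<close> \<open>y \<notin> I\<close> by (intro psubset_card_mono) auto
    moreover have "down_closed r (J - {y}) I"
      using less.prems \<open>y \<notin> I\<close> by (auto simp: down_closed_def)
    moreover have "z \<in> maximals r (J - {y})" using less.prems \<open>y \<noteq> z\<close> by (auto simp: maximals_def)
    ultimately have IH: "top_prob r (J - {y}) z \<le> top_prob r I z" using less by auto
    have "num_ext r (J - {z}) * num_ext r (J - {y}) \<le> num_ext r J * num_ext r (J - {y} - {z})"
      using num_ext_log_supermodular[OF less.prems(1) yJ less.prems(3) \<open>y \<noteq> z\<close>] by (simp add: mult.commute)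
    moreover have "num_ext r J > 0" "num_ext r (J - {y}) > 0" using num_ext_pos less.prems(1) by auto
    ultimately have "top_prob r J z \<le> top_prob r (J - {y}) z" by (simp add: top_prob_def field_simps)
    then show ?thesis using IH by simp
  qed simp
qed

text \<open>Both sides are compared through \<open>I \<inter> D\<close>, a down-set of
  \<open>I\<close> and of \<open>D\<close>. Passing to it raises top probabilities, which is used
  once directly for \<open>I\<close> and once for the complementary event in
  \<open>D\<close>.\<close>

lemma top_prob_exchange:
  assumes "finite S" "down_closed r S I" "down_closed r S D" "D \<noteq> {}"
  shows "(\<Sum>z\<in>maximals r I \<inter> (D - maximals r D). top_prob r I z) \<le> (\<Sum>x\<in>maximals r D - I. top_prob r D x)"
proof -
  define K where "K = I \<inter> D"
  have fin: "finite I" "finite D" "finite K"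
    using assms by (auto simp: down_closed_def K_def intro: finite_subset)
  have dc: "down_closed r I K" "down_closed r D K" using assms(2,3) by (auto simp: down_closed_def K_def)
  show ?thesis
  proof (cases "K = {}")
    case True
    then have "maximals r I \<inter> (D - maximals r D) = {}" using maximals_subset[of r I] by (auto simp: K_def)
    then show ?thesis by (simp add: sum_nonneg top_prob_nonneg)
  next
    case False
    have "(\<Sum>z\<in>maximals r I \<inter> (D - maximals r D). top_prob r I z)
        \<le> (\<Sum>z\<in>maximals r I \<inter> (D - maximals r D). top_prob r K z)"
      using top_prob_antimono[OF fin(1) dc(1)] maximals_subset[of r I]
      by (intro sum_mono) (auto simp: K_def)
    also have "\<dots> \<le> (\<Sum>z\<in>maximals r K - maximals r D. top_prob r K z)"
      using fin by (intro sum_mono2 top_prob_nonneg) (auto simp: maximals_def K_def)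
    also have "\<dots> = 1 - (\<Sum>z\<in>maximals r K \<inter> maximals r D. top_prob r K z)"
      using sum_top_prob[OF fin(3) False] sum.Int_Diff[of "maximals r K" "top_prob r K" "maximals r D"] fin
      by simp
    also have "\<dots> \<le> 1 - (\<Sum>z\<in>maximals r D \<inter> I. top_prob r D z)"
    proof -
      \<comment> \<open>A maximal element of \<open>D\<close> that lies in \<open>I\<close> stays
        maximal in the smaller set \<open>K\<close>.\<close>
      have "maximals r K \<inter> maximals r D = maximals r D \<inter> I" by (auto simp: maximals_def K_def)
      moreover have "(\<Sum>z\<in>maximals r D \<inter> I. top_prob r D z) \<le> (\<Sum>z\<in>maximals r D \<inter> I. top_prob r K z)"
        using top_prob_antimono[OF fin(2) dc(2)] maximals_subset[of r D]
        by (intro sum_mono) (auto simp: K_def)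
      ultimately show ?thesis by simp
    qed
    also have "\<dots> = (\<Sum>x\<in>maximals r D - I. top_prob r D x)"
      using sum_top_prob[OF fin(2) assms(4)] sum.Int_Diff[of "maximals r D" "top_prob r D" I] fin
      by simp
    finally show ?thesis .
  qed
qed

text \<open>The factor of \<^term>\<open>top_prob r D x\<close> is the number of nonempty initial segments of \<open>f\<close>
  that avoid \<open>x\<close>, whether or not \<open>x \<in> S\<close>; each segment is an instance of the exchange inequality.\<close>

lemma weighted_position_lower_bound:
  assumes "finite A" "down_closed r A D" "D \<noteq> {}" "down_closed r A S"
  shows "num_ext r S * real (card (S \<inter> (D - maximals r D))) \<le>
    (\<Sum>f\<in>extensions_on r S. \<Sum>x\<in>maximals r D.
       top_prob r D x * (if x \<in> S then real (f x) - 1 else real (card S)))"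
  using assms(4)
proof (induction "card S" arbitrary: S rule: less_induct)
  case less
  let ?M = "maximals r" and ?p = "top_prob r D" and ?e = "num_ext r"
  let ?X = "\<lambda>S (f :: 'a \<Rightarrow> nat) x. if x \<in> S then real (f x) - 1 else real (card S)"
  let ?N = "D - ?M D"
  have finS: "finite S" using less.prems assms(1) by (auto simp: down_closed_def intro: finite_subset)
  show ?case
  proof (cases "S = {}")
    case True
    then show ?thesis by (simp add: extensions_on_empty)
  next
    case False
    \<comment> \<open>The probability that the last element of \<open>D\<close> lies outside
      \<open>S\<close>. Adding a top element to an extension of \<open>S - {z}\<close> raises the
      inner sum on the right by exactly \<open>c\<close>.\<close>
    define c where "c = (\<Sum>x\<in>?M D - S. ?p x)"
    have finD: "finite D" using assms by (auto simp: down_closed_def intro: finite_subset)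
    have step: "(\<Sum>x\<in>?M D. ?p x * ?X S (f(z := card S)) x) = (\<Sum>x\<in>?M D. ?p x * ?X (S - {z}) f x) + c"
      if z: "z \<in> ?M S" for z f
    proof -
      have zS: "z \<in> S" using z by (simp add: maximals_def)
      have cS: "card S = Suc (card (S - {z}))" by (rule card.remove[OF finS zS])
      \<comment> \<open>For \<open>x = z\<close> both values are \<open>card S - 1\<close>: on the
        left the position minus one, on the right the default for an element outside
        \<open>S - {z}\<close>. So only elements outside \<open>S\<close> gain.\<close>
      have "?X S (f(z := card S)) x = ?X (S - {z}) f x + (if x \<in> S then 0 else 1)" for x
        using zS cS by auto
      then have "(\<Sum>x\<in>?M D. ?p x * ?X S (f(z := card S)) x)
          = (\<Sum>x\<in>?M D. ?p x * ?X (S - {z}) f x + (if x \<in> S then 0 else ?p x))"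
        by (intro sum.cong) (auto simp: algebra_simps)
      also have "\<dots> = (\<Sum>x\<in>?M D. ?p x * ?X (S - {z}) f x) + (\<Sum>x\<in>?M D. if x \<in> S then 0 else ?p x)"
        by (rule sum.distrib)
      also have "(\<Sum>x\<in>?M D. if x \<in> S then 0 else ?p x) = c"
        unfolding c_def using finD by (intro sum.mono_neutral_cong_right) auto
      finally show ?thesis .
    qed
    have IH: "?e (S - {z}) * real (card ((S - {z}) \<inter> ?N))
        \<le> (\<Sum>f\<in>extensions_on r (S - {z}). \<Sum>x\<in>?M D. ?p x * ?X (S - {z}) f x)"
      if z: "z \<in> ?M S" for z
    proof (rule less.hyps)
      show "card (S - {z}) < card S" using z finS maximals_subset[of r S] by (meson card_Diff1_less subsetD)
      have "z \<in> S" "\<forall>y\<in>S. (z, y) \<in> r \<longrightarrow> y = z" using z by (auto simp: maximals_def)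
      then show "down_closed r A (S - {z})" using less.prems
        by (auto simp: down_closed_def)
    qed
    \<comment> \<open>The exchange inequality for \<open>I = S\<close>, multiplied by
      \<open>?e S\<close>. Its left side counts the extensions of \<open>S\<close> whose top element
      lies in \<open>?N\<close>, which is what the left side of the claim gains in the induction
      step.\<close>
    have exch: "(\<Sum>z\<in>?M S \<inter> ?N. ?e (S - {z})) \<le> ?e S * c"
      using top_prob_exchange[OF assms(1) less.prems assms(2,3)] num_ext_pos[OF finS]
      by (simp add: c_def top_prob_def[of r S] sum_divide_distrib[symmetric] field_simps)
    have card_eq: "real (card (S \<inter> ?N)) = real (card ((S - {z}) \<inter> ?N)) + (if z \<in> ?N then 1 else 0)"
      if z: "z \<in> ?M S" for z
    proof -
      have zS: "z \<in> S" using z by (simp add: maximals_def)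
      show ?thesis
      proof (cases "z \<in> ?N")
        case True
        then have "S \<inter> ?N = insert z ((S - {z}) \<inter> ?N)" using zS by blast
        moreover have "z \<notin> (S - {z}) \<inter> ?N" by blast
        ultimately show ?thesis using True finS by simp
      next
        case False
        then have "S \<inter> ?N = (S - {z}) \<inter> ?N" by blast
        then show ?thesis using False by simp
      qed
    qed
    have "?e S * real (card (S \<inter> ?N)) = (\<Sum>z\<in>?M S. ?e (S - {z}) * real (card (S \<inter> ?N)))"
      using num_ext_rec[OF finS False, of r] by (simp add: sum_distrib_right)
    also have "\<dots> = (\<Sum>z\<in>?M S. ?e (S - {z}) * real (card ((S - {z}) \<inter> ?N))
        + (if z \<in> ?N then ?e (S - {z}) else 0))"
      by (intro sum.cong refl) (simp add: card_eq distrib_left)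
    also have "\<dots> = (\<Sum>z\<in>?M S. ?e (S - {z}) * real (card ((S - {z}) \<inter> ?N)))
        + (\<Sum>z\<in>?M S \<inter> ?N. ?e (S - {z}))"
      using finS by (simp add: sum.distrib sum.inter_restrict)
    also have "\<dots> \<le> (\<Sum>z\<in>?M S. \<Sum>f\<in>extensions_on r (S - {z}). \<Sum>x\<in>?M D. ?p x * ?X (S - {z}) f x) + ?e S * c"
      using exch IH by (intro add_mono sum_mono) auto
    also have "\<dots> = (\<Sum>z\<in>?M S. \<Sum>f\<in>extensions_on r (S - {z}). (\<Sum>x\<in>?M D. ?p x * ?X (S - {z}) f x) + c)"
      using num_ext_rec[OF finS False, of r]
      by (simp add: sum.distrib num_ext_def sum_distrib_right)
    also have "\<dots> = (\<Sum>z\<in>?M S. \<Sum>f\<in>extensions_on r (S - {z}). \<Sum>x\<in>?M D. ?p x * ?X S (f(z := card S)) x)"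
      by (intro sum.cong refl) (simp only: step)
    also have "\<dots> = (\<Sum>f\<in>extensions_on r S. \<Sum>x\<in>?M D. ?p x * ?X S f x)"
      by (rule sum_extensions_on[OF finS False, symmetric])
    finally show ?thesis .
  qed
qed

end

section \<open>Width, average heights and high elements of down-sets\<close>

lemma card_antichain_le_width:
  assumes "finite A" "antichain A r B"
  shows "card B \<le> width A r"
proof -
  have "{card B | B. antichain A r B} \<subseteq> card ` Pow A" by (auto simp: antichain_def)
  then have "finite {card B | B. antichain A r B}" using assms(1) by (meson finite_Pow_iff finite_imageI finite_subset)
  then show ?thesis unfolding width_def using assms(2) by (intro Max_ge) auto
qed

lemma width_converse: "width A (r\<inverse>) = width A r"
proof -
  have "antichain A (r\<inverse>) B = antichain A r B" for B by (auto simp: antichain_def)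
  then show ?thesis by (simp add: width_def)
qed

context
  fixes A :: "'a set" and r :: "'a rel"
  assumes fin: "finite A" and po: "partial_order_on A r"
begin

lemma extensions_on_carrier: "extensions_on r A = linear_extensions A r"
proof -
  have "Restr r A = r" using po by (auto simp: partial_order_on_def preorder_on_def)
  then show ?thesis by simp
qed

text \<open>Makes \<open>pmf_of_set\<close> genuinely uniform, so that \<open>avg_height\<close>
  unfolds to a plain average.\<close>

lemma card_linear_extensions_pos: "card (linear_extensions A r) > 0"
  using num_ext_pos[of r A] fin po extensions_on_carrier
  by (simp add: num_ext_def partial_order_on_def preorder_on_def)

lemma avg_height_eq:
  "avg_height A r x = (\<Sum>f\<in>linear_extensions A r. real (f x)) / real (card (linear_extensions A r))"
proof -
  have "linear_extensions A r \<noteq> {}" using card_linear_extensions_pos by force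
  then show ?thesis unfolding avg_height_def using fin by (simp add: integral_pmf_of_set)
qed

lemma avg_height_mono: "(x, y) \<in> r \<Longrightarrow> avg_height A r x \<le> avg_height A r y"
  unfolding avg_height_eq
  by (intro divide_right_mono sum_mono) (auto simp: linear_extensions_def)

text \<open>The weighted bound for \<open>S = A\<close> puts a \<open>top_prob\<close>-weighted
  average of the heights of the maximal elements of \<open>D\<close> at or above the number of
  non-maximal elements plus one. The largest of these heights is no smaller, and the maximal
  elements form an antichain.\<close>

lemma exists_high_element:
  assumes "down_closed r A D" "D \<noteq> {}"
  shows "\<exists>x\<in>D. avg_height A r x \<ge> real (card D) + 1 - real (width A r)"
proof -
  have tr: "trans r" and an: "antisym r" using po by (auto simp: partial_order_on_def preorder_on_def)
  let ?M = "maximals r D" and ?p = "top_prob r D" and ?L = "linear_extensions A r" and ?h = "avg_height A r"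
  have DA: "D \<subseteq> A" using assms by (auto simp: down_closed_def)
  have finD: "finite D" using DA fin finite_subset by blast
  have MA: "?M \<subseteq> A" using DA maximals_subset[of r D] by blast
  have ne: "?M \<noteq> {}" by (rule maximals_ne[OF tr an finD assms(2)])
  define N where "N = real (card ?L)"
  have N: "N > 0" using card_linear_extensions_pos by (simp add: N_def)
  define m where "m = Max (?h ` ?M)"
  have m_ge: "?h x \<le> m" if "x \<in> ?M" for x unfolding m_def using that finD by (intro Max_ge) auto
  have "down_closed r A A" by (auto simp: down_closed_def)
  from weighted_position_lower_bound[OF tr an fin assms this]
  have "N * real (card (A \<inter> (D - ?M))) \<le> (\<Sum>f\<in>?L. \<Sum>x\<in>?M. ?p x * (if x \<in> A then real (f x) - 1 else real (card A)))"
    unfolding num_ext_def extensions_on_carrier N_def .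
  also have "\<dots> = (\<Sum>f\<in>?L. \<Sum>x\<in>?M. ?p x * (real (f x) - 1))"
    using MA by (intro sum.cong refl) auto
  also have "\<dots> = (\<Sum>x\<in>?M. ?p x * ((\<Sum>f\<in>?L. real (f x)) - N))"
    by (subst sum.swap) (simp add: sum_distrib_left[symmetric] sum_subtractf N_def)
  also have "\<dots> = (\<Sum>x\<in>?M. ?p x * (N * (?h x - 1)))"
    using N by (intro sum.cong refl) (simp add: avg_height_eq N_def[symmetric] field_simps)
  also have "\<dots> \<le> (\<Sum>x\<in>?M. ?p x * (N * (m - 1)))"
    using m_ge N by (intro sum_mono mult_left_mono top_prob_nonneg[OF tr an]) auto
  also have "\<dots> = N * (m - 1)"
    using sum_top_prob[OF tr an finD assms(2)] by (simp add: sum_distrib_right[symmetric])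
  finally have "real (card (A \<inter> (D - ?M))) \<le> m - 1" using N by simp
  moreover have "A \<inter> (D - ?M) = D - ?M" using DA by blast
  moreover have "real (card (D - ?M)) = real (card D) - real (card ?M)"
    using finD maximals_subset[of r D] by (simp add: card_Diff_subset finite_subset card_mono of_nat_diff)
  moreover have "card ?M \<le> width A r"
    using fin MA by (intro card_antichain_le_width) (auto simp: antichain_def maximals_def)
  ultimately have "m \<ge> real (card D) + 1 - real (width A r)" by simp
  moreover have "m \<in> ?h ` ?M" unfolding m_def using finD ne by (intro Max_in) auto
  ultimately show ?thesis using maximals_subset[of r D] by blast
qed

end

section \<open>Duality by order reversal\<close>

lemma reverse_linear_extension:
  assumes "finite A" "f \<in> linear_extensions A r" "r \<subseteq> A \<times> A"
  shows "(\<lambda>x\<in>A. Suc (card A) - f x) \<in> linear_extensions A (r\<inverse>)"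
proof -
  have f: "bij_betw f A {1..card A}" "\<And>x y. (x, y) \<in> r \<Longrightarrow> f x \<le> f y"
    using assms(2) by (auto simp: linear_extensions_def)
  have "bij_betw (\<lambda>k. Suc (card A) - k) {1..card A} {1..card A}"
    by (rule bij_betw_byWitness[where f' = "\<lambda>k. Suc (card A) - k"]) auto
  from bij_betw_trans[OF f(1) this]
  have b: "bij_betw (\<lambda>x\<in>A. Suc (card A) - f x) A {1..card A}"
    by (subst bij_betw_cong[where g = "(\<lambda>k. Suc (card A) - k) \<circ> f"]) auto
  have "(\<lambda>x\<in>A. Suc (card A) - f x) \<in> A \<rightarrow>\<^sub>E {1..card A}"
    using b unfolding PiE_def bij_betw_def by auto
  moreover have "(\<lambda>x\<in>A. Suc (card A) - f x) y \<le> (\<lambda>x\<in>A. Suc (card A) - f x) x" if "(x, y) \<in> r" for x y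
    using f(2)[OF that] that assms(3) by (auto intro: diff_le_mono2)
  ultimately show ?thesis using b unfolding linear_extensions_def by blast
qed

text \<open>Reflecting labels by \<open>k\<close> to \<open>Suc (card A) - k\<close> is an
  involution, hence a bijection from the extensions of \<open>r\<close> to those of the
  converse.\<close>

lemma avg_height_converse:
  assumes "finite A" "partial_order_on A r" "x \<in> A"
  shows "avg_height A (r\<inverse>) x = real (card A) + 1 - avg_height A r x"
proof -
  let ?R = "\<lambda>f :: 'a \<Rightarrow> nat. \<lambda>x\<in>A. Suc (card A) - f x"
  let ?L = "linear_extensions A r"
  have sub: "r \<subseteq> A \<times> A" using assms by (auto simp: partial_order_on_def preorder_on_def)
  have po': "partial_order_on A (r\<inverse>)"
    using assms(2) by simp
  \<comment> \<open>Stated for any \<open>s\<close>, since the bijection needs it for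
    \<open>r\<close> and for its converse.\<close>
  have inv: "?R (?R f) = f" if "f \<in> linear_extensions A s" for f s
  proof
    fix x show "?R (?R f) x = f x"
    proof (cases "x \<in> A")
      case True
      then have "f x \<in> {1..card A}" using that by (auto simp: linear_extensions_def PiE_def)
      then show ?thesis using True by simp
    next
      case False
      then show ?thesis using that by (auto simp: linear_extensions_def PiE_def extensional_def)
    qed
  qed
  have bij: "bij_betw ?R ?L (linear_extensions A (r\<inverse>))"
  proof (rule bij_betw_byWitness[where f' = ?R])
    show "?R ` ?L \<subseteq> linear_extensions A (r\<inverse>)"
      using reverse_linear_extension[OF assms(1) _ sub] by blast
    show "?R ` linear_extensions A (r\<inverse>) \<subseteq> ?L"
      using reverse_linear_extension[OF assms(1), of _ "r\<inverse>"] sub by auto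
  qed (use inv in blast)+
  have le: "f x \<le> Suc (card A)" if "f \<in> ?L" for f
    using that assms(3) by (auto simp: linear_extensions_def PiE_def Pi_def le_SucI)
  have "(\<Sum>f\<in>linear_extensions A (r\<inverse>). real (f x)) = (\<Sum>f\<in>?L. real (?R f x))"
    by (rule sum.reindex_bij_betw[OF bij, symmetric])
  also have "\<dots> = (\<Sum>f\<in>?L. real (card A) + 1 - real (f x))"
    using le assms(3) by (intro sum.cong refl) (simp add: of_nat_diff)
  also have "\<dots> = real (card ?L) * (real (card A) + 1) - (\<Sum>f\<in>?L. real (f x))"
    by (simp add: sum_subtractf)
  finally show ?thesis
    using card_linear_extensions_pos[OF assms(1,2)]
    unfolding avg_height_eq[OF assms(1,2)] avg_height_eq[OF assms(1) po'] bij_betw_same_card[OF bij, symmetric]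
    by (simp add: field_simps)
qed

text \<open>An up-set is a down-set of the converse order, which has the same antichains; the bound
  is the reflection \<open>card A + 1 - (card U + 1 - width A r)\<close>.\<close>

lemma exists_low_element:
  assumes "finite A" "partial_order_on A r" "down_closed (r\<inverse>) A U" "U \<noteq> {}"
  shows "\<exists>y\<in>U. avg_height A r y \<le> real (card A) - real (card U) + real (width A r)"
proof -
  have po': "partial_order_on A (r\<inverse>)"
    using assms(2) by simp
  obtain y where y: "y \<in> U" "avg_height A (r\<inverse>) y \<ge> real (card U) + 1 - real (width A (r\<inverse>))"
    using exists_high_element[OF assms(1) po' assms(3,4)] by blast
  moreover have "y \<in> A" using y assms(3) by (auto simp: down_closed_def)
  ultimately show ?thesis
    using avg_height_converse[OF assms(1,2)] by (intro bexI[of _ y]) (auto simp: width_converse)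
qed

section \<open>Cutting the sorted heights at each gap\<close>

theorem corollary4p2:
  fixes A :: "'a set" and r :: "'a rel"
  assumes "finite A" and "A \<noteq> {}" and "partial_order_on A r"
  shows "gap A r \<le> 2 * real (width A r) - 1"
proof -
  let ?h = "avg_height A r"
  define s where "s = sorted_heights A r"
  define n where "n = card A"
  define w where "w = real (width A r)"
  have n: "n > 0" using assms by (simp add: n_def card_gt_0_iff)
  have srt: "sorted s" by (simp add: s_def sorted_heights_def)
  have set_s: "set s = ?h ` A" using assms(1) by (simp add: s_def sorted_heights_def)
  have len: "length s = n"
  proof -
    have "size (mset s) = n" unfolding s_def sorted_heights_def n_def by simp
    then show ?thesis by simp
  qed
  have nth: "\<exists>j<n. s ! j = ?h x" if "x \<in> A" for x
  proof -
    have "?h x \<in> set s" using that by (simp add: set_s)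
    then show ?thesis by (simp add: in_set_conv_nth len)
  qed
  \<comment> \<open>A singleton antichain gives \<open>w \<ge> 1\<close>. Hence
    \<open>w \<le> 2 * w - 1\<close>, which covers the two end gaps, and
    \<open>0 \<le> 2 * w - 1\<close>, which covers repeated heights.\<close>
  obtain a where "a \<in> A" using assms(2) by blast
  then have "card {a} \<le> width A r" using assms(1) by (intro card_antichain_le_width) (auto simp: antichain_def)
  then have w1: "w \<ge> 1" by (simp add: w_def)
  have all: "down_closed r A A" "down_closed (r\<inverse>) A A" by (auto simp: down_closed_def)
  \<comment> \<open>The end gaps use \<open>A\<close> itself, here as an up-set and next as a
    down-set.\<close>
  have first: "s ! 0 \<le> w"
  proof -
    obtain y where y: "y \<in> A" "?h y \<le> w"
      using exists_low_element[OF assms(1,3) all(2) assms(2)] by (auto simp: w_def)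
    then obtain j where "j < n" "s ! j = ?h y" using nth by blast
    then show ?thesis using y sorted_nth_mono[OF srt, of 0 j] len by simp
  qed
  have last: "real n + 1 - s ! (n - 1) \<le> w"
  proof -
    obtain y where y: "y \<in> A" "?h y \<ge> real n + 1 - w"
      using exists_high_element[OF assms(1,3) all(1) assms(2)] by (auto simp: w_def n_def)
    then obtain j where "j < n" "s ! j = ?h y" using nth by blast
    moreover have "j \<le> n - 1" using \<open>j < n\<close> by simp
    ultimately show ?thesis using y sorted_nth_mono[OF srt, of j "n - 1"] len n by simp
  qed
  have mid: "s ! Suc i - s ! i \<le> 2 * w - 1" if i: "Suc i < n" for i
  proof (cases "s ! i < s ! Suc i")
    case False
    then show ?thesis using w1 by simp
  next
    case True
    \<comment> \<open>The cut at the gap. Monotonicity of heights makes \<open>D\<close> a down-set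
      and \<open>U\<close> an up-set; they partition \<open>A\<close> because no height lies
      strictly between consecutive entries of \<open>s\<close> and these entries differ.\<close>
    define D where "D = {x \<in> A. ?h x \<le> s ! i}"
    define U where "U = {x \<in> A. ?h x \<ge> s ! Suc i}"
    have dc: "down_closed r A D" "down_closed (r\<inverse>) A U"
      using avg_height_mono[OF assms(1,3)] by (fastforce simp: down_closed_def D_def U_def)+
    have "s ! i \<in> ?h ` A" "s ! Suc i \<in> ?h ` A" using set_s len i by (auto simp flip: set_s)
    then have ne: "D \<noteq> {}" "U \<noteq> {}" by (auto simp: D_def U_def)
    have "x \<in> D \<union> U" if x: "x \<in> A" for x
    proof -
      obtain j where j: "j < n" "s ! j = ?h x" using nth[OF x] by blast
      then show ?thesis
        using sorted_nth_mono[OF srt, of j i] sorted_nth_mono[OF srt, of "Suc i" j] len i x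
        by (cases "j \<le> i") (auto simp: D_def U_def)
    qed
    then have "A = D \<union> U" by (auto simp: D_def U_def)
    moreover have "D \<inter> U = {}" using True by (auto simp: D_def U_def)
    moreover have "finite D" "finite U" using assms(1) by (auto simp: D_def U_def)
    ultimately have card: "card A = card D + card U" by (simp add: card_Un_disjoint)
    have "s ! i \<ge> real (card D) + 1 - w"
      using exists_high_element[OF assms(1,3) dc(1) ne(1)] by (force simp: w_def D_def)
    \<comment> \<open>The partition turns \<open>card A - card U\<close> into \<open>card D\<close>,
      which then cancels: \<open>(card D + w) - (card D + 1 - w) = 2 * w - 1\<close>.\<close>
    moreover have "s ! Suc i \<le> real (card D) + w"
      using exists_low_element[OF assms(1,3) dc(2) ne(2)] card by (force simp: w_def U_def)
    ultimately show ?thesis by simp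
  qed
  have "finite {s ! Suc i - s ! i | i. Suc i < n}"
    by (rule finite_subset[of _ "(\<lambda>i. s ! Suc i - s ! i) ` {..<n}"]) auto
  then show ?thesis
    unfolding gap_def Let_def s_def[symmetric] n_def[symmetric] w_def[symmetric]
    using first last mid w1 by (subst Max_le_iff) auto
qed

end
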